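(* Let $HE=\bigcup_{n=1}^{\infty}X_n\subset\mathbb{R}^2$ be the Hawaiian earring, where $X_n$ is the circle of radius $\frac1n$ centered at $(\frac1n,0)$, and let $p=(0,0)$. Then the topological fundamental group $\pi_1^{top}(HE,p)$ is not metrizable, i.e. there is no metric on the underlying set of $\pi_1^{top}(HE,p)$ that induces its topology.
   Context: For a metric space $X$ and $p\in X$, let $C_p(X)=\{f:[0,1]\to X \mid f \text{ is continuous and } f(0)=f(1)=p\}$, endowed with the topology of uniform convergence. The topological fundamental group $\pi_1^{top}(X,p)$ is the set of path components of $C_p(X)$, endowed with the quotient topology under the canonical surjection $\Pi:C_p(X)\to\pi_1^{top}(X,p)$, where $\Pi(f)=\Pi(g)$ if and only if $f$ and $g$ belong to the same path component of $C_p(X)$. Thus $U\subset\pi_1^{top}(X,p)$ is open if and only if $\Pi^{-1}(U)$ is open in $C_p(X)$. The Hawaiian earring $HE$ carries the metric (subspace) structure inherited from the Euclidean plane. *)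

theory Defs
  imports "HOL-Analysis.Analysis"
begin

definition loop_metric :: "'a metric \<Rightarrow> 'a \<Rightarrow> (real \<Rightarrow> 'a) metric" where
  "loop_metric m p =
     submetric (cfunspace (top_of_set {0..1}) m) {f. f 0 = p \<and> f 1 = p}"

text \<open>Loops are represented by functions that are \<^const>\<open>undefined\<close> off the unit interval.
  The boundedness built into \<^const>\<open>cfunspace\<close> is automatic, as the interval is compact.\<close>

lemma mspace_loop_metric:
  "mspace (loop_metric m p) =
     {f. pathin (mtopology_of m) f \<and> f \<in> extensional {0..1} \<and> f 0 = p \<and> f 1 = p}"
  unfolding loop_metric_def mspace_submetric
  by (subst compactin_mspace_cfunspace)
     (auto simp: pathin_def continuous_map_def Pi_iff)

lemma mdist_loop_metric:
  assumes "f \<in> mspace (loop_metric m p)" "g \<in> mspace (loop_metric m p)"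
  shows "mdist (loop_metric m p) f g = (SUP t\<in>{0..1}. mdist m (f t) (g t))"
  using assms
  by (auto simp: loop_metric_def cfunspace_def Metric_space.fdist_def)

definition loop_space :: "'a metric \<Rightarrow> 'a \<Rightarrow> (real \<Rightarrow> 'a) topology" where
  "loop_space m p = mtopology_of (loop_metric m p)"

definition quotient_topology :: "'a topology \<Rightarrow> ('a \<Rightarrow> 'b) \<Rightarrow> 'b topology" where
  "quotient_topology X f =
     topology (\<lambda>U. U \<subseteq> f ` topspace X \<and> openin X {x \<in> topspace X. f x \<in> U})"

lemma openin_quotient_topology:
  "openin (quotient_topology X f) U \<longleftrightarrow>
     U \<subseteq> f ` topspace X \<and> openin X {x \<in> topspace X. f x \<in> U}"
proof -
  have "istopology (\<lambda>U. U \<subseteq> f ` topspace X \<and> openin X {x \<in> topspace X. f x \<in> U})"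
    unfolding istopology_def
  proof (intro conjI allI impI)
    fix S T
    assume "S \<subseteq> f ` topspace X \<and> openin X {x \<in> topspace X. f x \<in> S}"
      and "T \<subseteq> f ` topspace X \<and> openin X {x \<in> topspace X. f x \<in> T}"
    moreover have "{x \<in> topspace X. f x \<in> S \<inter> T} =
        {x \<in> topspace X. f x \<in> S} \<inter> {x \<in> topspace X. f x \<in> T}"
      by auto
    ultimately show "S \<inter> T \<subseteq> f ` topspace X" "openin X {x \<in> topspace X. f x \<in> S \<inter> T}"
      by auto
  next
    fix \<K>
    assume K: "\<forall>K\<in>\<K>. K \<subseteq> f ` topspace X \<and> openin X {x \<in> topspace X. f x \<in> K}"
    have "{x \<in> topspace X. f x \<in> \<Union>\<K>} = (\<Union>K\<in>\<K>. {x \<in> topspace X. f x \<in> K})"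
      by auto
    with K show "\<Union>\<K> \<subseteq> f ` topspace X" "openin X {x \<in> topspace X. f x \<in> \<Union>\<K>}"
      by auto
  qed
  then show ?thesis
    by (simp add: quotient_topology_def topology_inverse')
qed

lemma topspace_quotient_topology: "topspace (quotient_topology X f) = f ` topspace X"
proof (rule antisym)
  show "topspace (quotient_topology X f) \<subseteq> f ` topspace X"
    using openin_quotient_topology[of X f] by blast
  have "{x \<in> topspace X. f x \<in> f ` topspace X} = topspace X"
    by auto
  then have "openin (quotient_topology X f) (f ` topspace X)"
    by (simp add: openin_quotient_topology)
  then show "f ` topspace X \<subseteq> topspace (quotient_topology X f)"
    by (rule openin_subset)
qed

lemma quotient_map_quotient_topology: "quotient_map X (quotient_topology X f) f"
  by (auto simp: quotient_map_def topspace_quotient_topology openin_quotient_topology)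

definition topological_pi1 :: "'a metric \<Rightarrow> 'a \<Rightarrow> (real \<Rightarrow> 'a) set topology" where
  "topological_pi1 m p =
     quotient_topology (loop_space m p) (path_component_of_set (loop_space m p))"

lemma topspace_topological_pi1:
  "topspace (topological_pi1 m p) = path_components_of (loop_space m p)"
  by (simp add: topological_pi1_def topspace_quotient_topology path_components_of_def)

text \<open>The distance on \<^typ>\<open>real \<times> real\<close> is the Euclidean one.\<close>

definition hawaiian_earring :: "(real \<times> real) set" where
  "hawaiian_earring = (\<Union>n\<in>{1::nat..}. sphere (1 / real n, 0) (1 / real n))"

end

theory Submission
  imports Defs
begin

text \<open>
  A loop whose class is \<open>[x\<^sub>1, x\<^sub>k]\<^sup>n\<close>, where \<open>x\<^sub>i\<close> runs once around the \<open>i\<close>-th circle, converges to a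
  null-homotopic loop as \<open>k\<close> grows. If the topology came from a metric, a choice
  of \<open>k\<^sub>n\<close> would therefore give classes \<open>[x\<^sub>1, x\<^bsub>k\<^sub>n\<^esub>]\<^sup>n\<close> converging to the identity. This is impossible: such
  a loop has to alternate about \<open>n\<close> times between the far point of the first circle and the far point of
  another one, whereas the loops near a fixed loop have a bounded number of large oscillations.

  To turn this into a homotopy invariant, map \<open>x\<^sub>1\<close> and \<open>x\<^sub>k\<close> to the two generating involutions of the infinite
  dihedral group and all other circles to the identity. The corresponding covering of two tangent circles is
  an infinite chain of circles. Dividing by the translations of the chain leaves a double covering, a ring of
  two circles, and folding each of them onto a half circle maps the ring to the unit circle. The
  winding number of a loop after these operations is locally constant, is \<open>2 * n\<close> for \<open>[x\<^sub>1, x\<^sub>k]\<^sup>n\<close>, and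
  each of its full turns uses both far points.
\<close>

section \<open>Lifting angles\<close>

lemma dist_cis: "dist (cis a) (cis b) = 2 * \<bar>sin ((a - b) / 2)\<bar>"
proof -
  have "(dist (cis a) (cis b))\<^sup>2 = (cos a - cos b)\<^sup>2 + (sin a - sin b)\<^sup>2"
    by (simp add: dist_norm cmod_power2)
  also have "\<dots> = 2 - 2 * cos (a - b)"
    using sin_cos_squared_add[of a] sin_cos_squared_add[of b]
    by (simp add: cos_diff power2_eq_square algebra_simps)
  also have "cos (a - b) = 1 - 2 * (sin ((a - b) / 2))\<^sup>2"
    by (metis cos_double_sin nonzero_mult_div_cancel_left times_divide_eq_right zero_neq_numeral)
  also have "2 - 2 * (1 - 2 * (sin ((a - b) / 2))\<^sup>2) = (2 * \<bar>sin ((a - b) / 2)\<bar>)\<^sup>2"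
    by (simp add: power_mult_distrib)
  finally show ?thesis
    by (rule power2_eq_imp_eq) auto
qed

text \<open>Starting at 0 makes the angle of a given \<open>g\<close> unique, so its value at 1 is a
  well-defined total angle.\<close>

definition is_angle :: "(real \<Rightarrow> complex) \<Rightarrow> (real \<Rightarrow> real) \<Rightarrow> bool" where
  "is_angle g \<theta> \<longleftrightarrow>
     continuous_on {0..1} \<theta> \<and> \<theta> 0 = 0 \<and> (\<forall>t\<in>{0..1}. g t = cis (\<theta> t))"

definition angle :: "(real \<Rightarrow> complex) \<Rightarrow> real \<Rightarrow> real" where
  "angle g = (SOME \<theta>. is_angle g \<theta>)"

text \<open>The interval is contractible, so \<open>g\<close> has a continuous logarithm. Its
  imaginary part is an angle up to a constant, which may be subtracted because
  \<open>g 0 = 1\<close>.\<close>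

lemma is_angle_angle:
  assumes g: "continuous_on {0..1} g" and norm1: "\<And>t. t \<in> {0..1} \<Longrightarrow> norm (g t) = 1"
    and g0: "g 0 = 1"
  shows "is_angle g (angle g)"
proof -
  have "\<And>t. t \<in> {0..1} \<Longrightarrow> g t \<noteq> 0"
    using norm1 by fastforce
  then obtain h where h: "continuous_on {0..1} h" "\<And>t. t \<in> {0..1} \<Longrightarrow> g t = exp (h t)"
    using continuous_logarithm_on_contractible[OF g] convex_imp_contractible[of "{0..1::real}"]
    by (metis convex_real_interval(5))
  have polar: "g t = cis (Im (h t))" if "t \<in> {0..1}" for t
    using h(2)[OF that] norm1[OF that] by (simp add: exp_eq_polar norm_mult)
  have "is_angle g (\<lambda>t. Im (h t) - Im (h 0))"
    unfolding is_angle_def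
  proof (intro conjI ballI)
    show "continuous_on {0..1} (\<lambda>t. Im (h t) - Im (h 0))"
      by (intro continuous_intros h)
    show "g t = cis (Im (h t) - Im (h 0))" if "t \<in> {0..1}" for t
      using polar[OF that] polar[of 0] g0 by (simp flip: cis_divide)
  qed auto
  then show ?thesis
    unfolding angle_def by (rule someI[of "is_angle g"])
qed

text \<open>If the angles ever differed by \<eta> or more, they would differ by exactly \<eta> at
  some time, and the two points would then be a chord \<open>2 * sin (\<eta> / 2)\<close>
  apart.\<close>

lemma angle_close:
  assumes "is_angle g \<theta>" "is_angle h \<phi>" and \<eta>: "0 < \<eta>" "\<eta> \<le> pi"
    and close: "\<And>t. t \<in> {0..1} \<Longrightarrow> dist (g t) (h t) < 2 * sin (\<eta> / 2)"
    and t: "t \<in> {0..1}"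
  shows "\<bar>\<theta> t - \<phi> t\<bar> < \<eta>"
proof (rule ccontr)
  let ?f = "\<lambda>t. \<bar>\<theta> t - \<phi> t\<bar>"
  assume "\<not> ?thesis"
  moreover have "continuous_on {0..t} ?f"
    using assms(1,2) t unfolding is_angle_def
    by (intro continuous_intros) (auto intro: continuous_on_subset)
  moreover have "?f 0 = 0"
    using assms(1,2) by (simp add: is_angle_def)
  ultimately obtain s where s: "0 \<le> s" "s \<le> t" "?f s = \<eta>"
    using IVT'[of ?f 0 \<eta> t] \<eta> t by auto
  then have "dist (g s) (h s) = 2 * \<bar>sin ((\<theta> s - \<phi> s) / 2)\<bar>"
    using assms(1,2) t by (simp add: is_angle_def dist_cis)
  also have "\<dots> = 2 * sin (\<eta> / 2)"
  proof -
    have "\<theta> s - \<phi> s = \<eta> \<or> \<theta> s - \<phi> s = - \<eta>"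
      using s(3) by linarith
    moreover have "sin (\<eta> / 2) \<ge> 0"
      using \<eta> by (intro sin_ge_zero) auto
    ultimately show ?thesis
      by auto
  qed
  finally show False
    using close[of s] s t by auto
qed

lemma angle_eqI:
  assumes "is_angle g \<theta>" "t \<in> {0..1}"
  shows "angle g t = \<theta> t"
proof (rule ccontr)
  assume ne: "angle g t \<noteq> \<theta> t"
  \<comment> \<open>The cap at \<open>pi\<close> is the bound that \<open>angle_close\<close> asks
    for; it is applied to two angles of the same \<open>g\<close>, where the chord is 0.\<close>
  define \<eta> where "\<eta> = min pi \<bar>angle g t - \<theta> t\<bar>"
  have \<eta>: "0 < \<eta>" "\<eta> \<le> pi"
    using ne by (auto simp: \<eta>_def)
  have "is_angle g (angle g)"
    unfolding angle_def by (rule someI[of "is_angle g", OF assms(1)])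
  from angle_close[OF this assms(1) \<eta> _ assms(2)]
  have "\<bar>angle g t - \<theta> t\<bar> < \<eta>"
    using \<eta> by (simp add: sin_gt_zero)
  then show False
    by (simp add: \<eta>_def)
qed

section \<open>Collapsing all but one circle\<close>

definition circle :: "nat \<Rightarrow> (real \<times> real) set" where
  "circle n = sphere (1 / real n, 0) (1 / real n)"

lemma hawaiian_earring_eq: "hawaiian_earring = (\<Union>n\<in>{1..}. circle n)"
  by (simp add: hawaiian_earring_def circle_def)

lemma mem_circle_iff:
  assumes "n \<ge> 1"
  shows "a \<in> circle n \<longleftrightarrow> (norm a)\<^sup>2 = 2 * fst a / n"
proof -
  have "a \<in> circle n \<longleftrightarrow> dist (1 / real n, 0) a = 1 / real n"
    by (simp add: circle_def)
  also have "\<dots> \<longleftrightarrow> (dist (1 / real n, 0) a)\<^sup>2 = (1 / real n)\<^sup>2"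
    by (metis of_nat_0_le_iff power2_eq_imp_eq zero_le_dist zero_le_divide_1_iff)
  also have "\<dots> \<longleftrightarrow> (norm a)\<^sup>2 = 2 * fst a / n"
  proof -
    have "(dist (1 / real n, 0) a)\<^sup>2 = (1 / n - fst a)\<^sup>2 + (snd a)\<^sup>2"
      by (simp add: dist_prod_def dist_real_def)
    moreover have "(norm a)\<^sup>2 = (fst a)\<^sup>2 + (snd a)\<^sup>2"
      by (simp add: norm_prod_def)
    ultimately show ?thesis
      by (auto simp: power2_diff)
  qed
  finally show ?thesis .
qed

lemma norm_circle_le:
  assumes "n \<ge> 1" "a \<in> circle n"
  shows "norm a \<le> 2 / n"
proof -
  have "norm a * norm a \<le> 2 / n * norm a"
    using assms norm_fst_le[of "fst a" "snd a"]
    by (simp add: mem_circle_iff power2_eq_square divide_right_mono)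
  then show ?thesis
    by (cases "a = 0") (simp_all del: times_divide_eq_left)
qed

definition collapse :: "nat \<Rightarrow> real \<times> real \<Rightarrow> real \<times> real" where
  "collapse n a = (if a \<in> circle n then a else 0)"

text \<open>The circle equations turn closeness of \<open>a\<close> and \<open>b\<close> into a
  bound on \<open>fst a\<close> times the gap between \<open>1 / n\<close> and \<open>1 / m\<close>.
  The gap is bounded below in terms of \<open>n\<close> alone, so the estimate is uniform in
  \<open>m\<close>, as uniform continuity of \<open>collapse n\<close> demands.\<close>

lemma norm_squared_le_dist_circles:
  assumes n: "n \<ge> 1" and m: "m \<ge> 1" and "n \<noteq> m" and a: "a \<in> circle n" and b: "b \<in> circle m"
  shows "(norm a)\<^sup>2 \<le> 6 * (real n + 1) * dist a b"
proof -
  have "2 / real n \<le> 2" "2 / real m \<le> 2"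
    using n m by (auto simp: field_simps)
  then have a2: "norm a \<le> 2" and b2: "norm b \<le> 2"
    using norm_circle_le[OF n a] norm_circle_le[OF m b] by linarith+
  have ab: "\<bar>norm a - norm b\<bar> \<le> dist a b"
    using norm_triangle_ineq3[of a b] by (simp add: dist_norm)
  have fd: "\<bar>fst a - fst b\<bar> \<le> dist a b"
    using dist_fst_le[of a b] by (simp add: dist_real_def)
  have "\<bar>(norm a)\<^sup>2 - (norm b)\<^sup>2\<bar> = (norm a + norm b) * \<bar>norm a - norm b\<bar>"
    by (simp add: square_diff_square_factored power2_eq_square abs_mult)
  also have "\<dots> \<le> 4 * dist a b"
    using a2 b2 ab by (intro mult_mono) auto
  finally have "\<bar>fst a / n - fst b / m\<bar> \<le> 2 * dist a b"
    using a b n m by (simp add: mem_circle_iff)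
  moreover have "fst a / n - fst a / m = (fst a / n - fst b / m) - (fst a - fst b) / m"
    by (simp add: diff_divide_distrib)
  moreover have "\<bar>(fst a - fst b) / m\<bar> \<le> dist a b"
  proof -
    have "\<bar>fst a - fst b\<bar> / m \<le> \<bar>fst a - fst b\<bar> / 1"
      using m by (intro divide_left_mono) auto
    then show ?thesis using fd by simp
  qed
  ultimately have le: "\<bar>fst a / n - fst a / m\<bar> \<le> 3 * dist a b"
    by linarith
  have "fst a \<ge> 0"
  proof -
    have "0 \<le> n * (norm a)\<^sup>2 / 2"
      by simp
    also have "\<dots> = fst a"
      using a n by (simp add: mem_circle_iff)
    finally show ?thesis .
  qed
  have "fst a / n - fst a / m = fst a * (1 / n - 1 / m)"
    by (simp add: right_diff_distrib)
  with \<open>fst a \<ge> 0\<close> le have "fst a * \<bar>1 / n - 1 / m\<bar> \<le> 3 * dist a b"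
    by (simp only: abs_mult abs_of_nonneg)
  \<comment> \<open>Among the other reciprocals, \<open>1 / (n + 1)\<close> is the closest to
    \<open>1 / n\<close>.\<close>
  moreover have "\<bar>1 / n - 1 / m\<bar> \<ge> 1 / (real n * (real n + 1))"
  proof (cases "m \<le> n")
    case True
    then have "real m + 1 \<le> n" using \<open>n \<noteq> m\<close> by linarith
    have "1 / (real n * (real n + 1)) \<le> 1 / (real n * real m)"
      using n m True by (intro divide_left_mono mult_left_mono) auto
    also have "\<dots> \<le> (real n - real m) / (real n * real m)"
      using \<open>real m + 1 \<le> n\<close> by (intro divide_right_mono) auto
    also have "\<dots> = 1 / m - 1 / n"
      using n m by (simp add: field_simps)
    finally show ?thesis by linarith
  next
    case False
    then have "real m \<ge> n + 1" by linarith
    then have "1 / (real n + 1) \<ge> 1 / m"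
      using n by (intro divide_left_mono) auto
    moreover have "1 / (real n * (real n + 1)) = 1 / n - 1 / (real n + 1)"
      using n by (simp add: field_simps)
    ultimately show ?thesis by linarith
  qed
  ultimately have "fst a * (1 / (real n * (real n + 1))) \<le> 3 * dist a b"
    using \<open>fst a \<ge> 0\<close> by (blast intro: mult_left_mono order_trans)
  moreover have "real n * (real n + 1) > 0"
    using n by simp
  ultimately have "fst a \<le> 3 * dist a b * (real n * (real n + 1))"
    by (simp only: times_divide_eq_right mult_1_right pos_divide_le_eq)
  then have "fst a / n \<le> 3 * (real n + 1) * dist a b"
    using n by (simp add: pos_divide_le_eq algebra_simps)
  then have "2 * (fst a / n) \<le> 6 * (real n + 1) * dist a b"
    by linarith
  then show ?thesis
    using a n by (simp add: mem_circle_iff)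
qed

text \<open>The circles are tangent at the origin, so collapsing is only Hoelder continuous.\<close>

lemma uniformly_continuous_collapse:
  assumes n: "n \<ge> 1"
  shows "uniformly_continuous_on hawaiian_earring (collapse n)"
  unfolding uniformly_continuous_on_def
proof (intro allI impI)
  fix e :: real assume "e > 0"
  \<comment> \<open>The first bound serves two points of circle \<open>n\<close>. The second serves
    one point on it and one off it, whose images are as far apart as the norm of the former.\<close>
  define d where "d = min e (e\<^sup>2 / (6 * (real n + 1)))"
  have small: "norm a < e"
    if ab: "a \<in> circle n" "b \<notin> circle n" "b \<in> hawaiian_earring" "dist a b < d" for a b
  proof -
    obtain m where m: "m \<ge> 1" "b \<in> circle m"
      using ab(3) by (auto simp: hawaiian_earring_eq)
    then have "(norm a)\<^sup>2 \<le> 6 * (real n + 1) * dist a b"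
      using ab n by (intro norm_squared_le_dist_circles) auto
    also have "\<dots> < e\<^sup>2"
      using ab(4) by (simp add: d_def field_simps)
    finally show ?thesis
      using \<open>e > 0\<close> by (simp add: power2_less_imp_less)
  qed
  have "dist (collapse n b) (collapse n a) < e"
    if "a \<in> hawaiian_earring" "b \<in> hawaiian_earring" "dist b a < d" for a b
    using that small[of a b] small[of b a] \<open>e > 0\<close>
    by (auto simp: collapse_def dist_commute d_def)
  moreover have "d > 0"
    using \<open>e > 0\<close> by (simp add: d_def)
  ultimately show "\<exists>d>0. \<forall>a\<in>hawaiian_earring. \<forall>b\<in>hawaiian_earring.
      dist b a < d \<longrightarrow> dist (collapse n b) (collapse n a) < e"
    by blast
qed

text \<open>By their equations, two distinct circles meet only at the origin.\<close>

lemma collapse_cases: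
  assumes "n \<ge> 1" "m \<ge> 1" "n \<noteq> m"
  shows "collapse n a = 0 \<or> collapse m a = 0"
proof (rule ccontr)
  assume *: "\<not> ?thesis"
  then have a: "a \<in> circle n" "a \<in> circle m" "a \<noteq> 0"
    by (auto simp: collapse_def split: if_splits)
  then have "2 * fst a / n = 2 * fst a / m"
    using assms by (simp add: mem_circle_iff)
  then have "fst a = 0"
    using assms by (auto simp: field_simps)
  then have "(norm a)\<^sup>2 = 0"
    using a assms by (simp add: mem_circle_iff)
  with a show False
    by simp
qed

lemma norm_collapse:
  assumes "n \<ge> 1"
  shows "(norm (collapse n a))\<^sup>2 = 2 * fst (collapse n a) / n"
  using assms by (simp add: collapse_def mem_circle_iff)

lemma collapse_0 [simp]: "collapse n 0 = 0"
  by (simp add: collapse_def)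

section \<open>The dihedral winding number\<close>

text \<open>For \<open>k \<ge> 2\<close> at most one summand is nonzero. Scaling gives both circles
  radius 1, and a reflection with a shift carries them onto the unit circle, with the origin going
  to 1.\<close>

definition wrap :: "nat \<Rightarrow> real \<times> real \<Rightarrow> complex" where
  "wrap k a = 
     Complex (1 - fst (collapse 1 a + real k *\<^sub>R collapse k a))
       (snd (collapse 1 a + real k *\<^sub>R collapse k a))"

text \<open>For \<open>k \<ge> 2\<close> the sign tells the two circles apart, and 1 and -1 are
  reached only at their far points.\<close>

definition fold_circles :: "nat \<Rightarrow> real \<times> real \<Rightarrow> real" where
  "fold_circles k a = (norm (collapse 1 a) - k * norm (collapse k a)) / 2"

lemma wrap_0 [simp]: "wrap k 0 = 1" and fold_circles_0 [simp]: "fold_circles k 0 = 0"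
  by (simp_all add: wrap_def fold_circles_def complex_eq_iff)

lemma norm_wrap:
  assumes "k \<ge> 2"
  shows "norm (wrap k a) = 1"
proof -
  have sq: "(norm b)\<^sup>2 = (fst b)\<^sup>2 + (snd b)\<^sup>2" for b :: "real \<times> real"
    by (simp add: norm_prod_def)
  have "(norm (wrap k a))\<^sup>2 = 1"
  proof (cases "collapse k a = 0")
    case True
    then show ?thesis
      using norm_collapse[of 1 a]
      by (simp add: wrap_def cmod_power2 sq power2_diff)
  next
    case False
    then have "collapse 1 a = 0"
      using collapse_cases[of 1 k a] assms by auto
    let ?x = "fst (collapse k a)" and ?y = "snd (collapse k a)"
    have eq: "(real k)\<^sup>2 * (?x\<^sup>2 + ?y\<^sup>2) = 2 * real k * ?x"
      using norm_collapse[of k a] assms by (simp flip: sq) (simp add: power2_eq_square)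
    have "(norm (wrap k a))\<^sup>2 = (1 - real k * ?x)\<^sup>2 + (real k * ?y)\<^sup>2"
      using \<open>collapse 1 a = 0\<close> by (simp add: wrap_def cmod_power2)
    also have "\<dots> = 1 - 2 * real k * ?x + (real k)\<^sup>2 * (?x\<^sup>2 + ?y\<^sup>2)"
      by (simp add: power2_eq_square algebra_simps)
    also have "\<dots> = 1"
      using eq by simp
    finally show ?thesis .
  qed
  then show ?thesis
    by (metis norm_ge_zero one_power2 power2_eq_imp_eq zero_le_one)
qed

text \<open>This is the half-angle formula: where \<open>wrap\<close> is
  \<open>cis \<theta>\<close>, \<open>fold_circles\<close> is \<open>sin (\<theta> / 2)\<close> up
  to sign. It is what puts \<open>spin\<close> on the unit circle.\<close>

lemma Re_wrap:
  assumes "k \<ge> 2"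
  shows "Re (wrap k a) = 1 - 2 * (fold_circles k a)\<^sup>2"
proof (cases "collapse k a = 0")
  case True
  then show ?thesis
    using norm_collapse[of 1 a] by (simp add: wrap_def fold_circles_def power_divide)
next
  case False
  then have "collapse 1 a = 0"
    using collapse_cases[of 1 k a] assms by auto
  then show ?thesis
    using norm_collapse[of k a] assms
    by (simp add: wrap_def fold_circles_def power_divide power_mult_distrib field_simps power2_eq_square)
qed

lemma uniformly_continuous_wrap:
  assumes "k \<ge> 2"
  shows "uniformly_continuous_on hawaiian_earring (wrap k)"
proof -
  have lin: "bounded_linear (\<lambda>b::real \<times> real. Complex (- fst b) (snd b))"
    by (rule bounded_linear_intro[where K = 1])
       (auto simp: complex_eq_iff cmod_def norm_prod_def)
  have "wrap k = (\<lambda>a. 1 + Complex (- fst (collapse 1 a + real k *\<^sub>R collapse k a))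
      (snd (collapse 1 a + real k *\<^sub>R collapse k a)))"
    by (simp add: fun_eq_iff wrap_def complex_eq_iff)
  moreover have "uniformly_continuous_on hawaiian_earring \<dots>"
    using assms
    by (intro uniformly_continuous_on_add uniformly_continuous_on_const
          bounded_linear.uniformly_continuous_on[OF lin] uniformly_continuous_on_cmul
          uniformly_continuous_collapse) auto
  ultimately show ?thesis
    by simp
qed

lemma uniformly_continuous_fold_circles:
  assumes "k \<ge> 2"
  shows "uniformly_continuous_on hawaiian_earring (fold_circles k)"
proof -
  have "fold_circles k =
      (\<lambda>a. (1 / 2) *\<^sub>R (norm (collapse 1 a) - real k *\<^sub>R norm (collapse k a)))"
    by (simp add: fun_eq_iff fold_circles_def)
  moreover have "uniformly_continuous_on hawaiian_earring \<dots>"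
    using assms
    by (intro uniformly_continuous_on_cmul uniformly_continuous_on_diff
          uniformly_continuous_on_norm uniformly_continuous_collapse) auto
  ultimately show ?thesis
    by simp
qed

section \<open>The index of a loop and its local behaviour\<close>

definition earring_loop :: "(real \<Rightarrow> real \<times> real) \<Rightarrow> bool" where
  "earring_loop f \<longleftrightarrow>
     continuous_on {0..1} f \<and> f ` {0..1} \<subseteq> hawaiian_earring \<and> f 0 = 0 \<and> f 1 = 0"

text \<open>\<open>cis (turn k f t / 2)\<close> together with the circle containing \<open>f t\<close> is the lift of \<open>f\<close> to the double
  covering, and \<open>spin k f\<close> is its image under the folding map. On the \<open>i\<close>-th circle, the point at angle
  \<open>\<theta>\<close> has norm \<open>(2 / i) * \<bar>sin (\<theta> / 2)\<bar>\<close>, which is why \<^const>\<open>fold_circles\<close> is given by norms. The index is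
  the total angle, not divided by \<open>2 * pi\<close>.\<close>

definition turn :: "nat \<Rightarrow> (real \<Rightarrow> real \<times> real) \<Rightarrow> real \<Rightarrow> real" where
  "turn k f = angle (\<lambda>t. wrap k (f t))"

definition spin :: "nat \<Rightarrow> (real \<Rightarrow> real \<times> real) \<Rightarrow> real \<Rightarrow> complex" where
  "spin k f t = Complex (cos (turn k f t / 2)) (fold_circles k (f t))"

definition index :: "nat \<Rightarrow> (real \<Rightarrow> real \<times> real) \<Rightarrow> real" where
  "index k f = angle (spin k f) 1"

lemma is_angle_turn:
  assumes "k \<ge> 2" "earring_loop f"
  shows "is_angle (\<lambda>t. wrap k (f t)) (turn k f)"
  unfolding turn_def
proof (rule is_angle_angle)
  show "continuous_on {0..1} (\<lambda>t. wrap k (f t))"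
    using assms(2) by (intro continuous_on_compose2
        [OF uniformly_continuous_imp_continuous[OF uniformly_continuous_wrap[OF assms(1)]]])
      (auto simp: earring_loop_def)
qed (use assms in \<open>auto simp: norm_wrap earring_loop_def\<close>)

lemma is_angle_spin:
  assumes "k \<ge> 2" "earring_loop f"
  shows "is_angle (spin k f) (angle (spin k f))"
proof (rule is_angle_angle)
  have turn: "continuous_on {0..1} (turn k f)" "turn k f 0 = 0"
    "\<And>t. t \<in> {0..1} \<Longrightarrow> wrap k (f t) = cis (turn k f t)"
    using is_angle_turn[OF assms] by (auto simp: is_angle_def)
  have "continuous_on {0..1} (\<lambda>t. fold_circles k (f t))"
    using assms(2) by (intro continuous_on_compose2
        [OF uniformly_continuous_imp_continuous[OF uniformly_continuous_fold_circles[OF assms(1)]]])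
      (auto simp: earring_loop_def)
  then show "continuous_on {0..1} (spin k f)"
    unfolding spin_def[abs_def] Complex_eq by (intro continuous_intros turn) auto
  show "spin k f 0 = 1"
    using assms turn by (simp add: spin_def earring_loop_def complex_eq_iff)
  fix t :: real assume t: "t \<in> {0..1}"
  \<comment> \<open>Two expressions for the real part of \<open>wrap\<close>; equating them says
    that the squared coordinates of \<open>spin\<close> sum to 1.\<close>
  have "1 - 2 * (fold_circles k (f t))\<^sup>2 = cos (turn k f t)"
    using Re_wrap[OF assms(1), of "f t"] turn(3)[OF t] by simp
  also have "\<dots> = 2 * (cos (turn k f t / 2))\<^sup>2 - 1"
    by (metis cos_double_cos nonzero_mult_div_cancel_left times_divide_eq_right zero_neq_numeral)
  finally have "(norm (spin k f t))\<^sup>2 = 1"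
    by (simp add: spin_def cmod_power2)
  then show "norm (spin k f t) = 1"
    by (metis norm_ge_zero one_power2 power2_eq_imp_eq zero_le_one)
qed

lemma cis_eq_imp_eq:
  assumes "cis a = cis b" "\<bar>a - b\<bar> < 2 * pi"
  shows "a = b"
proof -
  have "sin ((a - b) / 2) = 0"
    using dist_cis[of a b] assms(1) by simp
  then show ?thesis
    using sin_eq_0_pi[of "(a - b) / 2"] assms(2) by (auto simp: abs_if split: if_splits)
qed

text \<open>Nearby loops have nearby \<open>turn\<close>, hence nearby \<open>spin\<close>, hence
  nearby total angles. Both loops end at the origin, which forces the end values to agree modulo
  \<open>2 * pi\<close>, and being close they are then equal.\<close>

lemma index_locally_constant:
  assumes "k \<ge> 2" "earring_loop f"
  obtains \<delta> where "\<delta> > 0"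
    "\<And>g. \<lbrakk>earring_loop g; \<And>t. t \<in> {0..1} \<Longrightarrow> dist (f t) (g t) < \<delta>\<rbrakk> \<Longrightarrow> index k g = index k f"
proof -
  \<comment> \<open>This is the chord of the angle 1, the tolerance chosen for
    \<open>turn\<close>.\<close>
  have "2 * sin (1 / 2) > (0::real)"
    using pi_gt3 by (intro mult_pos_pos sin_gt_zero) auto
  then obtain d1 where d1: "d1 > 0" "\<And>a b. \<lbrakk>a \<in> hawaiian_earring; b \<in> hawaiian_earring; dist a b < d1\<rbrakk>
      \<Longrightarrow> dist (wrap k a) (wrap k b) < 2 * sin (1 / 2)"
    using uniformly_continuous_wrap[OF assms(1)] unfolding uniformly_continuous_on_def by metis
  obtain d2 where d2: "d2 > 0" "\<And>a b. \<lbrakk>a \<in> hawaiian_earring; b \<in> hawaiian_earring; dist a b < d2\<rbrakk>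
      \<Longrightarrow> dist (fold_circles k a) (fold_circles k b) < 1 / 2"
    using uniformly_continuous_fold_circles[OF assms(1)] unfolding uniformly_continuous_on_def
    by (metis half_gt_zero_iff zero_less_one)
  show thesis
  proof
    show "min d1 d2 > 0"
      using d1 d2 by simp
    fix g assume g: "earring_loop g" and close: "\<And>t. t \<in> {0..1} \<Longrightarrow> dist (f t) (g t) < min d1 d2"
    have in_HE: "f t \<in> hawaiian_earring" "g t \<in> hawaiian_earring" if "t \<in> {0..1}" for t
      using that assms(2) g by (auto simp: earring_loop_def)
    have turn: "\<bar>turn k f t - turn k g t\<bar> < 1" if "t \<in> {0..1}" for t
      using d1 in_HE close that pi_gt3
      by (intro angle_close[OF is_angle_turn[OF assms] is_angle_turn[OF assms(1) g]]) auto
    \<comment> \<open>Each coordinate moves by less than 1/2, and the chord of the angle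
      \<open>pi / 2\<close> exceeds 1.\<close>
    have spin: "dist (spin k f t) (spin k g t) < 2 * sin (pi / 2 / 2)" if t: "t \<in> {0..1}" for t
    proof -
      have "\<bar>cos (turn k f t / 2) - cos (turn k g t / 2)\<bar> \<le> dist (cis (turn k f t / 2)) (cis (turn k g t / 2))"
        using abs_Re_le_cmod[of "cis (turn k f t / 2) - cis (turn k g t / 2)"] by (simp add: dist_norm)
      also have "\<dots> \<le> \<bar>turn k f t - turn k g t\<bar> / 2"
        using abs_sin_x_le_abs_x[of "(turn k f t / 2 - turn k g t / 2) / 2"] by (simp add: dist_cis)
      also have "\<dots> < 1 / 2"
        using turn[OF t] by simp
      finally have "\<bar>cos (turn k f t / 2) - cos (turn k g t / 2)\<bar> < 1 / 2" .
      moreover have "\<bar>fold_circles k (f t) - fold_circles k (g t)\<bar> < 1 / 2"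
        using d2(2)[OF in_HE[OF t]] close[OF t] by (simp add: dist_real_def)
      moreover have "dist (spin k f t) (spin k g t) \<le>
          \<bar>cos (turn k f t / 2) - cos (turn k g t / 2)\<bar> + \<bar>fold_circles k (f t) - fold_circles k (g t)\<bar>"
        using cmod_le[of "spin k f t - spin k g t"] by (simp add: dist_norm spin_def)
      moreover have "2 * sin (pi / 2 / 2) > 1"
        by (simp add: sin_45)
      ultimately show ?thesis
        by linarith
    qed
    have index: "\<bar>angle (spin k f) 1 - angle (spin k g) 1\<bar> < pi / 2"
      using spin by (intro angle_close[OF is_angle_spin[OF assms] is_angle_spin[OF assms(1) g]]) auto
    \<comment> \<open>Equality of \<open>wrap\<close> at the common endpoint first fixes
      \<open>turn\<close>, then \<open>spin\<close>, then the angle of \<open>spin\<close>.\<close>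
    have "cis (turn k f 1) = cis (turn k g 1)"
      using is_angle_turn[OF assms] is_angle_turn[OF assms(1) g] assms(2) g
      by (auto simp: is_angle_def earring_loop_def dest!: bspec[of _ _ 1])
    then have "turn k f 1 = turn k g 1"
      using turn[of 1] pi_gt3 by (intro cis_eq_imp_eq) auto
    then have "spin k f 1 = spin k g 1"
      using assms(2) g by (simp add: spin_def earring_loop_def)
    then have "cis (angle (spin k f) 1) = cis (angle (spin k g) 1)"
      using is_angle_spin[OF assms] is_angle_spin[OF assms(1) g] by (simp add: is_angle_def)
    then have "angle (spin k f) 1 = angle (spin k g) 1"
      using index pi_gt3 by (intro cis_eq_imp_eq) auto
    then show "index k g = index k f"
      by (simp add: index_def)
  qed
qed

text \<open>The far point of the first circle has norm 2, that of circle \<open>k\<close> norm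
  \<open>2 / k\<close>. These norms differ by at least 1 for every \<open>k\<close>, which makes the
  later bound on the index independent of \<open>k\<close>.\<close>

lemma fold_circles_extreme:
  assumes "k \<ge> 2"
  shows "fold_circles k a = 1 \<Longrightarrow> norm a = 2" and "fold_circles k a = - 1 \<Longrightarrow> norm a \<le> 1"
proof -
  show "norm a = 2" if *: "fold_circles k a = 1"
  proof -
    have "collapse 1 a \<noteq> 0"
    proof
      assume "collapse 1 a = 0"
      then have "fold_circles k a \<le> 0"
        by (simp add: fold_circles_def)
      with * show False
        by simp
    qed
    moreover from this have "collapse k a = 0"
      using collapse_cases[of 1 k a] assms by auto
    ultimately show ?thesis
      using * by (auto simp: fold_circles_def collapse_def split: if_splits)
  qed
  show "norm a \<le> 1" if *: "fold_circles k a = - 1"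
  proof -
    have "collapse k a \<noteq> 0"
    proof
      assume "collapse k a = 0"
      then have "fold_circles k a \<ge> 0"
        by (simp add: fold_circles_def)
      with * show False
        by simp
    qed
    then have "a \<in> circle k"
      by (auto simp: collapse_def split: if_splits)
    then have "norm a \<le> 2 / k"
      using assms by (intro norm_circle_le) auto
    also have "\<dots> \<le> 1"
      using assms by simp
    finally show ?thesis .
  qed
qed

lemma cis_surj_on_interval:
  assumes "b - a \<ge> 2 * pi"
  obtains y where "y \<in> {a..b}" "cis y = cis c"
proof
  define m where "m = \<lceil>(a - c) / (2 * pi)\<rceil>"
  have "(a - c) / (2 * pi) \<le> m" "m < (a - c) / (2 * pi) + 1"
    unfolding m_def by linarith+
  then have "a - c \<le> 2 * pi * m" "2 * pi * m < a - c + 2 * pi"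
    by (auto simp: field_simps)
  then show "c + 2 * pi * m \<in> {a..b}"
    using assms by auto
  show "cis (c + 2 * pi * m) = cis c"
    by (simp flip: cis_mult)
qed

text \<open>A full turn of \<open>spin\<close> visits both far points, so \<open>g\<close> moves by
  at least 1. On short intervals \<open>f\<close> moves by less than 1/4 and \<open>g\<close> stays
  within 1/4 of \<open>f\<close>, so \<open>g\<close> moves by less than 3/4. Thus \<open>N\<close>
  depends on the modulus of continuity of \<open>f\<close> only, not on \<open>k\<close>.\<close>

lemma index_locally_bounded:
  assumes f: "earring_loop f"
  obtains N :: nat where
    "\<And>k g. \<lbrakk>k \<ge> 2; earring_loop g; \<And>t. t \<in> {0..1} \<Longrightarrow> dist (f t) (g t) < 1 / 4\<rbrakk>
       \<Longrightarrow> \<bar>index k g\<bar> \<le> 2 * pi * N"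
proof -
  have "uniformly_continuous_on {0..1} f"
    using f by (intro compact_uniformly_continuous) (auto simp: earring_loop_def)
  then obtain \<delta> where \<delta>: "\<delta> > 0"
    "\<And>s t. \<lbrakk>s \<in> {0..1}; t \<in> {0..1}; dist s t < \<delta>\<rbrakk> \<Longrightarrow> dist (f s) (f t) < 1 / 4"
    unfolding uniformly_continuous_on_def by (metis zero_less_divide_1_iff zero_less_numeral)
  obtain N :: nat where N: "N > 0" "1 / N < \<delta>"
    using \<delta>(1) by (metis nat_approx_posE zero_less_Suc)
  show thesis
  proof
    fix k :: nat and g assume k: "k \<ge> 2" and g: "earring_loop g"
      and close: "\<And>t. t \<in> {0..1} \<Longrightarrow> dist (f t) (g t) < 1 / 4"
    define \<beta> where "\<beta> = angle (spin k g)"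
    have \<beta>: "continuous_on {0..1} \<beta>" "\<beta> 0 = 0" "\<And>t. t \<in> {0..1} \<Longrightarrow> spin k g t = cis (\<beta> t)"
      using is_angle_spin[OF k g] by (auto simp: \<beta>_def is_angle_def)
    have step: "\<bar>\<beta> t - \<beta> s\<bar> \<le> 2 * pi" if st: "0 \<le> s" "s \<le> t" "t \<le> 1" "t - s < \<delta>" for s t
    proof (rule ccontr)
      assume *: "\<not> ?thesis"
      define a b where "a = min (\<beta> s) (\<beta> t)" and "b = max (\<beta> s) (\<beta> t)"
      have len: "b - a \<ge> 2 * pi"
        using * by (auto simp: a_def b_def)
      have "{a..b} \<subseteq> \<beta> ` {s..t}"
      proof (rule connected_contains_Icc)
        show "connected (\<beta> ` {s..t})"
          using st by (intro connected_continuous_image continuous_on_subset[OF \<beta>(1)]) auto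
      qed (use st in \<open>auto simp: a_def b_def min_def max_def\<close>)
      then have attained: "\<exists>x\<in>{s..t}. cis (\<beta> x) = cis c" for c
        using cis_surj_on_interval[OF len, of c] by (metis imageE subsetD)
      \<comment> \<open>At these times \<open>spin\<close> is the imaginary unit and its
        negative.\<close>
      obtain x y where x: "x \<in> {s..t}" "cis (\<beta> x) = cis (pi / 2)"
        and y: "y \<in> {s..t}" "cis (\<beta> y) = cis (- (pi / 2))"
        using attained[of "pi / 2"] attained[of "- (pi / 2)"] by blast
      have "fold_circles k (g x) = 1"
        using x st \<beta>(3)[of x] by (simp add: spin_def complex_eq_iff)
      moreover have "fold_circles k (g y) = - 1"
        using y st \<beta>(3)[of y] by (simp add: spin_def complex_eq_iff)
      ultimately have "norm (g x) - norm (g y) \<ge> 1"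
        using fold_circles_extreme[OF k] by fastforce
      then have "dist (g x) (g y) \<ge> 1"
        using norm_triangle_ineq2[of "g x" "g y"] by (simp add: dist_norm)
      moreover have "dist (f x) (f y) < 1 / 4"
        using x y st by (intro \<delta>) (auto simp: dist_real_def)
      moreover have "dist (f x) (g x) < 1 / 4" "dist (f y) (g y) < 1 / 4"
        using close[of x] close[of y] x y st by auto
      moreover have "dist (g x) (g y) \<le> dist (f x) (g x) + dist (f x) (f y) + dist (f y) (g y)"
        by metric
      ultimately show False
        by linarith
    qed
    \<comment> \<open>The interval is cut into \<open>N\<close> pieces shorter than \<delta>, each
      contributing at most one turn.\<close>
    have "\<bar>\<beta> (i / N)\<bar> \<le> 2 * pi * i" if "i \<le> N" for i
      using that
    proof (induction i)
      case (Suc i)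
      have "\<bar>\<beta> (Suc i / N) - \<beta> (i / N)\<bar> \<le> 2 * pi"
        using Suc N by (intro step) (auto simp: divide_simps)
      moreover have "\<bar>\<beta> (i / N)\<bar> \<le> 2 * pi * i"
        using Suc by simp
      ultimately show ?case
        by (simp add: algebra_simps)
    qed (simp add: \<beta>(2))
    from this[of N] show "\<bar>index k g\<bar> \<le> 2 * pi * N"
      using N by (simp add: index_def \<beta>_def)
  qed
qed

section \<open>Powers of commutators\<close>

text \<open>A trapezoid wave of period 4: the \<open>arccos\<close> term is the distance from
  \<open>L\<close> to the nearest point of the form \<open>3 / 2 + 4 * m\<close>, and the result is
  clipped to the unit interval. A single formula gives continuity and periodicity without
  gluing.\<close>

definition ramp :: "real \<Rightarrow> real" where
  "ramp L = max 0 (min 1 (3 / 2 - 2 / pi * arccos (cos (pi / 2 * (L - 3 / 2)))))"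

definition petal :: "real \<Rightarrow> real \<times> real" where
  "petal y = (1 - cos (2 * pi * y), sin (2 * pi * y))"

text \<open>The factor \<open>c = 1 / k\<close> gives the \<open>n\<close>-th power of the commutator of the first and the \<open>k\<close>-th circle, while
  \<open>c = 0\<close> gives the limit loop in the first circle.\<close>

definition commutator_loop :: "nat \<Rightarrow> real \<Rightarrow> real \<Rightarrow> real \<times> real" where
  "commutator_loop n c t = petal (ramp (4 * real n * t)) + c *\<^sub>R petal (ramp (4 * real n * t - 1))"

lemma continuous_ramp: "continuous_on UNIV ramp"
  unfolding ramp_def[abs_def] by (intro continuous_intros) auto

lemma ramp_bounds: "0 \<le> ramp L" "ramp L \<le> 1"
  by (auto simp: ramp_def)

lemma ramp_periodic: "ramp (L + 4 * of_int m) = ramp L"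
proof -
  have "pi / 2 * (L + 4 * of_int m - 3 / 2) = pi / 2 * (L - 3 / 2) + 2 * pi * of_int m"
    by (simp add: algebra_simps)
  then have "cos (pi / 2 * (L + 4 * of_int m - 3 / 2)) = cos (pi / 2 * (L - 3 / 2))"
    by (simp only: cos_add) simp
  then show ?thesis
    by (simp add: ramp_def)
qed

text \<open>On this range the argument of \<open>cos\<close> stays between \<open>- pi\<close> and
  \<open>pi\<close>, where \<open>arccos\<close> of \<open>cos\<close> is the absolute
  value.\<close>

lemma ramp_middle:
  assumes "- 1 / 2 \<le> L" "L \<le> 7 / 2"
  shows "ramp L = max 0 (min 1 (3 / 2 - \<bar>L - 3 / 2\<bar>))"
proof -
  have "\<bar>pi / 2 * (L - 3 / 2)\<bar> = pi / 2 * \<bar>L - 3 / 2\<bar>"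
    by (simp add: abs_mult)
  moreover have "pi / 2 * \<bar>L - 3 / 2\<bar> \<le> pi / 2 * 2"
    using assms by (intro mult_left_mono) auto
  ultimately have "arccos (cos (pi / 2 * (L - 3 / 2))) = pi / 2 * \<bar>L - 3 / 2\<bar>"
    by (subst arccos_cos_eq_abs) auto
  then show ?thesis
    by (simp only: ramp_def) simp
qed

lemma ramp_values:
  shows "\<lbrakk>- 1 \<le> L; L \<le> 0\<rbrakk> \<Longrightarrow> ramp L = 0"
    and "\<lbrakk>0 \<le> L; L \<le> 1\<rbrakk> \<Longrightarrow> ramp L = L"
    and "\<lbrakk>1 \<le> L; L \<le> 2\<rbrakk> \<Longrightarrow> ramp L = 1"
    and "\<lbrakk>2 \<le> L; L \<le> 3\<rbrakk> \<Longrightarrow> ramp L = 3 - L"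
    and "\<lbrakk>3 \<le> L; L \<le> 4\<rbrakk> \<Longrightarrow> ramp L = 0"
proof -
  show "ramp L = 0" if "- 1 \<le> L" "L \<le> 0"
    using that ramp_middle[of L] ramp_middle[of "L + 4"] ramp_periodic[of L 1]
    by (cases "- 1 / 2 \<le> L") (auto simp: abs_if)
  then show "ramp L = 0" if "3 \<le> L" "L \<le> 4"
    using that ramp_middle[of L] ramp_middle[of "L - 4"] ramp_periodic[of "L - 4" 1]
    by (cases "L \<le> 7 / 2") (auto simp: abs_if)
  show "ramp L = L" if "0 \<le> L" "L \<le> 1"
    using that ramp_middle[of L] by auto
  show "ramp L = 1" if "1 \<le> L" "L \<le> 2"
    using that ramp_middle[of L] by auto
  show "ramp L = 3 - L" if "2 \<le> L" "L \<le> 3"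
    using that ramp_middle[of L] by auto
qed

lemma petal_0_1 [simp]: "petal 0 = 0" "petal 1 = 0"
  by (simp_all add: petal_def zero_prod_def)

text \<open>The point \<open>(ramp L, ramp (L - 1))\<close> runs along the boundary of the unit square,
  parametrised by arc length.\<close>

lemma ramp_square:
  shows "petal (ramp L) = 0 \<or> petal (ramp (L - 1)) = 0"
    and "cos (pi * (ramp L + ramp (L - 1))) = cos (pi * L)"
    and "sin (pi * ramp L) - sin (pi * ramp (L - 1)) = sin (pi * L)"
proof -
  \<comment> \<open>All quantities have period 4 in \<open>L\<close>, so one lap suffices; the four
    cases below are the sides of the square.\<close>
  define m where "m = \<lfloor>L / 4\<rfloor>"
  define x where "x = L - 4 * of_int m"
  have x: "0 \<le> x" "x \<le> 4"
    unfolding x_def m_def by linarith+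
  have L: "L = x + 4 * of_int m"
    by (simp add: x_def)
  have ramp_L: "ramp L = ramp x" "ramp (L - 1) = ramp (x - 1)"
    using ramp_periodic[of x m] ramp_periodic[of "x - 1" m] by (auto simp: L algebra_simps)
  have "pi * L = pi * x + 2 * pi * of_int (2 * m)"
    by (simp add: L algebra_simps)
  then have trig_L: "cos (pi * L) = cos (pi * x)" "sin (pi * L) = sin (pi * x)"
    by (simp_all only: cos_add sin_add cos_int_2pin sin_int_2pin)
  have turn: "cos (pi * (1 + (x - 1))) = cos (pi * x)" "cos (pi * (3 - x + 1)) = cos (pi * x)"
    "cos (pi * (3 - (x - 1))) = cos (pi * x)"
    "sin (pi * (x - 1)) = - sin (pi * x)" "sin (pi * (3 - x)) = sin (pi * x)"
    "sin (pi * (3 - (x - 1))) = - sin (pi * x)"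
  proof -
    have 3: "pi * (3 - x) = 2 * pi + (pi - pi * x)" and 4: "pi * (4 - x) = 2 * pi + (2 * pi - pi * x)"
      and 1: "pi * (x - 1) = pi * x - pi"
      by (simp_all add: algebra_simps)
    show "cos (pi * (1 + (x - 1))) = cos (pi * x)"
      by simp
    have "3 - x + 1 = 4 - x" "3 - (x - 1) = 4 - x"
      by simp_all
    then show "cos (pi * (3 - x + 1)) = cos (pi * x)" "cos (pi * (3 - (x - 1))) = cos (pi * x)"
      "sin (pi * (3 - (x - 1))) = - sin (pi * x)"
      by (simp_all only: 4 cos_add sin_add cos_diff sin_diff) simp_all
    show "sin (pi * (x - 1)) = - sin (pi * x)"
      by (simp only: 1 sin_diff) simp
    show "sin (pi * (3 - x)) = sin (pi * x)"
      by (simp only: 3 sin_add cos_diff sin_diff) simp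
  qed
  consider "x \<le> 1" | "1 \<le> x" "x \<le> 2" | "2 \<le> x" "x \<le> 3" | "3 \<le> x"
    by linarith
  then have "(petal (ramp x) = 0 \<or> petal (ramp (x - 1)) = 0) \<and>
      cos (pi * (ramp x + ramp (x - 1))) = cos (pi * x) \<and>
      sin (pi * ramp x) - sin (pi * ramp (x - 1)) = sin (pi * x)"
  proof cases
    case 1
    then have "ramp x = x" "ramp (x - 1) = 0"
      using x by (simp_all add: ramp_values)
    then show ?thesis
      by simp
  next
    case 2
    then have "ramp x = 1" "ramp (x - 1) = x - 1"
      by (simp_all add: ramp_values)
    then show ?thesis
      by (simp only: turn) simp
  next
    case 3
    then have "ramp x = 3 - x" "ramp (x - 1) = 1"
      by (simp_all add: ramp_values)
    then show ?thesis
      by (simp only: turn) simp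
  next
    case 4
    then have "ramp x = 0" "ramp (x - 1) = 3 - (x - 1)"
      using x by (simp_all add: ramp_values)
    then show ?thesis
      by (simp only: turn add_0) simp
  qed
  then show "petal (ramp L) = 0 \<or> petal (ramp (L - 1)) = 0"
    and "cos (pi * (ramp L + ramp (L - 1))) = cos (pi * L)"
    and "sin (pi * ramp L) - sin (pi * ramp (L - 1)) = sin (pi * L)"
    by (simp_all only: ramp_L trig_L)
qed

section \<open>Petals, and the index of the commutator loops\<close>

lemma norm_petal_squared: "(norm (petal y))\<^sup>2 = 2 * fst (petal y)"
proof -
  have "(norm (petal y))\<^sup>2 = (1 - cos (2 * pi * y))\<^sup>2 + (sin (2 * pi * y))\<^sup>2"
    by (simp add: petal_def norm_prod_def)
  then show ?thesis
    using sin_cos_squared_add[of "2 * pi * y"] by (simp add: petal_def power2_diff)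
qed

lemma norm_petal: "norm (petal y) = 2 * \<bar>sin (pi * y)\<bar>"
proof (rule power2_eq_imp_eq)
  have "cos (2 * (pi * y)) = 1 - 2 * (sin (pi * y))\<^sup>2"
    by (rule cos_double_sin)
  then show "(norm (petal y))\<^sup>2 = (2 * \<bar>sin (pi * y)\<bar>)\<^sup>2"
    unfolding norm_petal_squared by (simp add: petal_def power_mult_distrib mult.assoc)
qed auto

lemma scaled_petal_in_circle:
  assumes "n \<ge> 1"
  shows "(1 / real n) *\<^sub>R petal y \<in> circle n"
  using assms norm_petal_squared[of y]
  by (simp add: mem_circle_iff power_divide power2_eq_square)

lemma petal_in_circle: "petal y \<in> circle 1"
  using scaled_petal_in_circle[of 1 y] by simp

lemma collapse_other:
  assumes "n \<ge> 1" "m \<ge> 1" "n \<noteq> m" "a \<in> circle n"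
  shows "collapse m a = 0"
  using collapse_cases[OF assms(1-3), of a] assms(4) by (auto simp: collapse_def)

lemma petal_eq_0_iff: "petal y = 0 \<longleftrightarrow> cis (2 * pi * y) = 1"
  by (auto simp: petal_def zero_prod_def complex_eq_iff)

text \<open>One petal vanishes, so the point lies on a single circle, and the vanishing petal
  contributes the factor 1 to \<open>cis\<close>. Hence the angles add up in both cases.\<close>

lemma wrap_petals:
  assumes k: "k \<ge> 2" and zero: "petal u = 0 \<or> petal v = 0"
  shows "wrap k (petal u + (1 / k) *\<^sub>R petal v) = cis (2 * pi * (u + v))"
    and "fold_circles k (petal u + (1 / k) *\<^sub>R petal v) = \<bar>sin (pi * u)\<bar> - \<bar>sin (pi * v)\<bar>"
proof -
  let ?a = "petal u + (1 / k) *\<^sub>R petal v"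
  have split: "cis (2 * pi * (u + v)) = cis (2 * pi * u) * cis (2 * pi * v)"
    by (simp add: cis_mult distrib_left)
  have "collapse 1 ?a = petal u \<and> collapse k ?a = (1 / k) *\<^sub>R petal v \<and>
      wrap k ?a = cis (2 * pi * (u + v))"
  proof (cases "petal v = 0")
    case True
    then have "collapse 1 ?a = petal u" "collapse k ?a = 0"
      using collapse_other[of 1 k "petal u"] k petal_in_circle by (auto simp: collapse_def)
    moreover have "cis (2 * pi * v) = 1"
      using True petal_eq_0_iff by blast
    ultimately show ?thesis
      using True by (simp add: wrap_def split petal_def complex_eq_iff)
  next
    case False
    then have u: "petal u = 0"
      using zero by simp
    then have "collapse 1 ?a = 0" "collapse k ?a = (1 / k) *\<^sub>R petal v"
      using collapse_other[of k 1 "(1 / k) *\<^sub>R petal v"] k scaled_petal_in_circle[of k v]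
      by (auto simp: collapse_def)
    moreover have "cis (2 * pi * u) = 1"
      using u petal_eq_0_iff by blast
    ultimately show ?thesis
      using u k by (simp add: wrap_def split petal_def complex_eq_iff)
  qed
  then show "wrap k ?a = cis (2 * pi * (u + v))"
    and "fold_circles k ?a = \<bar>sin (pi * u)\<bar> - \<bar>sin (pi * v)\<bar>"
    using k by (simp_all add: fold_circles_def norm_petal field_simps)
qed

text \<open>Up to an isometry \<open>petal\<close> is \<open>cis\<close>, and a chord is no longer
  than its arc.\<close>

lemma dist_petal: "dist (petal x) (petal y) \<le> 2 * pi * \<bar>x - y\<bar>"
proof -
  have "dist (petal x) (petal y) = dist (cis (2 * pi * x)) (cis (2 * pi * y))"
    by (simp add: petal_def dist_prod_def dist_real_def dist_norm cmod_def power2_commute)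
  also have "\<dots> \<le> 2 * \<bar>(2 * pi * x - 2 * pi * y) / 2\<bar>"
    unfolding dist_cis by (intro mult_left_mono abs_sin_x_le_abs_x) auto
  also have "\<dots> = 2 * pi * \<bar>x - y\<bar>"
    by (simp add: abs_mult flip: right_diff_distrib)
  finally show ?thesis .
qed

lemma continuous_petal: "continuous_on UNIV petal"
  unfolding petal_def[abs_def] by (intro continuous_intros)

lemma ramp_end: "ramp (4 * real n) = 0" "ramp (4 * real n - 1) = 0"
  using ramp_periodic[of 0 "int n"] ramp_periodic[of "-1" "int n"]
  by (simp_all add: ramp_values)

text \<open>These loops are the stages of a null-homotopy of \<open>commutator_loop n 0\<close>,
  reached at \<open>s = 1\<close>. The arc parameter is shrunk rather than the point, so they stay
  on the first circle.\<close>

lemma earring_loop_shrunk_petals: "earring_loop (\<lambda>t. petal (s * ramp (4 * real n * t)))"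
  unfolding earring_loop_def
proof (intro conjI)
  show "continuous_on {0..1} (\<lambda>t. petal (s * ramp (4 * real n * t)))"
    by (intro continuous_on_compose2[OF continuous_petal] continuous_on_mult_left
        continuous_on_compose2[OF continuous_ramp] continuous_intros) auto
qed (use petal_in_circle in \<open>auto simp: hawaiian_earring_eq ramp_values ramp_end[simplified]\<close>)

lemma earring_loop_commutator_loop:
  assumes "k \<ge> 2"
  shows "earring_loop (commutator_loop n (1 / real k))"
  unfolding earring_loop_def
proof (intro conjI image_subsetI)
  show "continuous_on {0..1} (commutator_loop n (1 / real k))"
    unfolding commutator_loop_def[abs_def]
    by (intro continuous_on_add continuous_on_scaleR continuous_on_compose2[OF continuous_petal]
        continuous_on_compose2[OF continuous_ramp] continuous_intros) auto
  fix t
  have "commutator_loop n (1 / real k) t \<in> circle 1 \<union> circle k"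
    using ramp_square(1)[of "4 * real n * t"] petal_in_circle scaled_petal_in_circle[of k] assms
    by (auto simp: commutator_loop_def)
  then show "commutator_loop n (1 / real k) t \<in> hawaiian_earring"
    using assms by (fastforce simp: hawaiian_earring_eq)
qed (simp_all add: commutator_loop_def ramp_values ramp_end)

text \<open>In each lap \<open>turn\<close> rises to \<open>4 * pi\<close> and returns to 0, so it
  alone detects nothing. Together with the sign in \<open>fold_circles\<close>, the identities of
  \<open>ramp_square\<close> make \<open>spin\<close> equal to \<open>cis (pi * L)\<close> with
  \<open>L = 4 * n * t\<close>: two full turns per commutator.\<close>

lemma index_commutator_loop:
  assumes k: "k \<ge> 2"
  shows "index k (commutator_loop n (1 / real k)) = 4 * pi * n"
proof -
  let ?w = "commutator_loop n (1 / real k)"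
  let ?u = "\<lambda>t. ramp (4 * real n * t)" and ?v = "\<lambda>t. ramp (4 * real n * t - 1)"
  have "is_angle (\<lambda>t. wrap k (?w t)) (\<lambda>t. 2 * pi * (?u t + ?v t))"
    unfolding is_angle_def
  proof (intro conjI ballI)
    show "continuous_on {0..1} (\<lambda>t. 2 * pi * (?u t + ?v t))"
      by (intro continuous_on_mult_left continuous_on_add
          continuous_on_compose2[OF continuous_ramp] continuous_intros) auto
    show "wrap k (?w t) = cis (2 * pi * (?u t + ?v t))" for t
      unfolding commutator_loop_def using k ramp_square(1) by (rule wrap_petals)
  qed (simp add: ramp_values)
  then have turn: "turn k ?w t = 2 * pi * (?u t + ?v t)" if "t \<in> {0..1}" for t
    unfolding turn_def using that by (rule angle_eqI)
  have "is_angle (spin k ?w) (\<lambda>t. 4 * pi * n * t)"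
    unfolding is_angle_def
  proof (intro conjI ballI)
    fix t :: real assume t: "t \<in> {0..1}"
    have nonneg: "sin (pi * ramp L) \<ge> 0" for L
      using ramp_bounds[of L] by (intro sin_ge_zero) (auto intro: mult_left_le)
    have "fold_circles k (?w t) = \<bar>sin (pi * ?u t)\<bar> - \<bar>sin (pi * ?v t)\<bar>"
      unfolding commutator_loop_def using k ramp_square(1) by (rule wrap_petals)
    also have "\<dots> = sin (pi * (4 * n * t))"
      using ramp_square(3)[of "4 * n * t"] nonneg by simp
    finally have "spin k ?w t = cis (pi * (4 * n * t))"
      using ramp_square(2)[of "4 * n * t"] turn[OF t]
      by (simp add: spin_def complex_eq_iff mult.assoc)
    then show "spin k ?w t = cis (4 * pi * n * t)"
      by (simp add: mult_ac)
  qed (auto intro!: continuous_intros)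
  then show ?thesis
    unfolding index_def using angle_eqI[of _ _ 1] by fastforce
qed

lemma dist_commutator_loop_limit:
  assumes "c \<ge> 0"
  shows "dist (commutator_loop n c t) (commutator_loop n 0 t) \<le> 2 * c"
proof -
  have "norm (petal y) \<le> 2" for y
    by (simp add: norm_petal)
  then show ?thesis
    using assms by (simp add: commutator_loop_def dist_norm mult.commute mult_left_mono)
qed

section \<open>The loop space of the earring\<close>

definition earring :: "(real \<times> real) metric" where
  "earring = submetric euclidean_metric hawaiian_earring"

lemma mspace_loop_earring:
  "f \<in> mspace (loop_metric earring (0, 0)) \<longleftrightarrow> earring_loop f \<and> f \<in> extensional {0..1}"
  by (auto simp: mspace_loop_metric earring_def earring_loop_def mtopology_of_submetric pathin_def
      continuous_map_in_subtopology zero_prod_def)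

lemma dist_le_mdist_loop_earring:
  assumes "f \<in> mspace (loop_metric earring (0, 0))" "g \<in> mspace (loop_metric earring (0, 0))"
    and t: "t \<in> {0..1}"
  shows "dist (f t) (g t) \<le> mdist (loop_metric earring (0, 0)) f g"
proof -
  have loops: "earring_loop f" "earring_loop g"
    using assms by (auto simp: mspace_loop_earring)
  have "continuous_on {0..1} (\<lambda>t. dist (f t) (g t))"
    using loops by (intro continuous_on_dist) (auto simp: earring_loop_def)
  then have "bdd_above ((\<lambda>t. dist (f t) (g t)) ` {0..1})"
    by (intro bounded_imp_bdd_above compact_imp_bounded compact_continuous_image) auto
  then have "dist (f t) (g t) \<le> (SUP t\<in>{0..1}. dist (f t) (g t))"
    using t by (intro cSUP_upper) auto
  then show ?thesis
    using assms by (simp add: mdist_loop_metric) (simp add: earring_def)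
qed

lemma mdist_loop_earring_le:
  assumes "f \<in> mspace (loop_metric earring (0, 0))" "g \<in> mspace (loop_metric earring (0, 0))"
    and "\<And>t. t \<in> {0..1} \<Longrightarrow> dist (f t) (g t) \<le> B"
  shows "mdist (loop_metric earring (0, 0)) f g \<le> B"
proof -
  have "(SUP t\<in>{0..1}. dist (f t) (g t)) \<le> B"
    using assms(3) by (intro cSUP_least) auto
  then show ?thesis
    using assms(1,2) by (simp add: mdist_loop_metric) (simp add: earring_def)
qed

lemma earring_loop_cong:
  assumes "\<And>t. t \<in> {0..1} \<Longrightarrow> f t = g t"
  shows "earring_loop f \<longleftrightarrow> earring_loop g"
proof -
  have "continuous_on {0..1} f \<longleftrightarrow> continuous_on {0..1} g" "f ` {0..1} = g ` {0..1}"
    using assms by (auto intro!: continuous_on_cong image_cong)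
  then show ?thesis
    using assms[of 0] assms[of 1] by (simp add: earring_loop_def)
qed

lemma restrict_in_mspace_loop_earring:
  "earring_loop f \<Longrightarrow> restrict f {0..1} \<in> mspace (loop_metric earring (0, 0))"
  using earring_loop_cong[of "restrict f {0..1}" f] by (simp add: mspace_loop_earring)

text \<open>Restriction changes the function to which the choice in \<open>angle\<close> is applied.
  Local constancy, used for two loops at distance 0, shows that the index does not notice.\<close>

lemma index_restrict:
  assumes "k \<ge> 2" "earring_loop f"
  shows "index k (restrict f {0..1}) = index k f"
proof -
  have "earring_loop (restrict f {0..1})"
    using assms(2) earring_loop_cong[of "restrict f {0..1}" f] by simp
  moreover obtain \<delta> where "\<delta> > 0"
    "\<And>g. \<lbrakk>earring_loop g; \<And>t. t \<in> {0..1} \<Longrightarrow> dist (f t) (g t) < \<delta>\<rbrakk> \<Longrightarrow> index k g = index k f"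
    using index_locally_constant[OF assms] by blast
  ultimately show ?thesis
    by simp
qed

section \<open>The index as an invariant of path components\<close>

lemma topspace_loop_space [simp]: "topspace (loop_space m p) = mspace (loop_metric m p)"
  by (simp add: loop_space_def)

lemma openin_loop_spaceI:
  assumes "U \<subseteq> mspace (loop_metric m p)"
    and "\<And>f. f \<in> U \<Longrightarrow>
      \<exists>r>0. \<forall>g\<in>mspace (loop_metric m p). mdist (loop_metric m p) f g < r \<longrightarrow> g \<in> U"
  shows "openin (loop_space m p) U"
proof -
  interpret L: Metric_space "mspace (loop_metric m p)" "mdist (loop_metric m p)"
    by (rule Metric_space_mspace_mdist)
  show ?thesis
    using assms unfolding loop_space_def mtopology_of_def L.openin_mtopology
    by (force simp: subset_iff)
qed

lemma openin_index:
  assumes "k \<ge> 2"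
  shows "openin (loop_space earring (0, 0)) {f \<in> mspace (loop_metric earring (0, 0)). P (index k f)}"
proof (rule openin_loop_spaceI)
  fix f assume f: "f \<in> {f \<in> mspace (loop_metric earring (0, 0)). P (index k f)}"
  then obtain \<delta> where \<delta>: "\<delta> > 0"
    "\<And>g. \<lbrakk>earring_loop g; \<And>t. t \<in> {0..1} \<Longrightarrow> dist (f t) (g t) < \<delta>\<rbrakk> \<Longrightarrow> index k g = index k f"
    using index_locally_constant[OF assms, of f] by (auto simp: mspace_loop_earring)
  have "index k g = index k f"
    if "g \<in> mspace (loop_metric earring (0, 0))" "mdist (loop_metric earring (0, 0)) f g < \<delta>" for g
    using that f by (intro \<delta>(2)) (auto simp: mspace_loop_earring
        intro!: le_less_trans[OF dist_le_mdist_loop_earring])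
  then show "\<exists>r>0. \<forall>g\<in>mspace (loop_metric earring (0, 0)). mdist (loop_metric earring (0, 0)) f g < r \<longrightarrow>
      g \<in> {f \<in> mspace (loop_metric earring (0, 0)). P (index k f)}"
    using f \<delta>(1) by (intro exI[of _ \<delta>]) auto
qed auto

lemma closedin_index:
  assumes "k \<ge> 2"
  shows "closedin (loop_space earring (0, 0)) {f \<in> mspace (loop_metric earring (0, 0)). P (index k f)}"
proof -
  have "mspace (loop_metric earring (0, 0)) - {f \<in> mspace (loop_metric earring (0, 0)). P (index k f)}
      = {f \<in> mspace (loop_metric earring (0, 0)). \<not> P (index k f)}"
    by auto
  then show ?thesis
    using openin_index[OF assms, of "\<lambda>x. \<not> P x"] by (auto simp: closedin_def)
qed

text \<open>A path component is connected, and the level sets of the index are clopen.\<close>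

lemma index_path_component:
  assumes "k \<ge> 2" "path_component_of (loop_space earring (0, 0)) f g"
  shows "index k f = index k g"
proof -
  let ?X = "loop_space earring (0, 0)"
  have f: "f \<in> topspace ?X" and g: "g \<in> topspace ?X"
    using assms(2) by (auto simp: path_component_in_topspace dest: path_component_in_topspace)
  have "connectedin ?X (path_component_of_set ?X f)"
    by (simp add: path_connectedin_imp_connectedin path_connectedin_path_component_of)
  from connectedin_clopen_cases[OF this closedin_index[OF assms(1), of "\<lambda>x. x = index k f"]
      openin_index[OF assms(1), of "\<lambda>x. x = index k f"]]
  have "path_component_of_set ?X f \<subseteq> {h \<in> topspace ?X. index k h = index k f} \<or>
      disjnt (path_component_of_set ?X f) {h \<in> topspace ?X. index k h = index k f}"
    by simp
  moreover have "f \<in> path_component_of_set ?X f"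
    using f by (simp add: path_component_of_refl)
  ultimately show ?thesis
    using f assms(2) by (auto simp: disjnt_iff)
qed

section \<open>Convergence of the commutator loops and the closed set they generate\<close>

definition commutator_path :: "nat \<Rightarrow> real \<Rightarrow> real \<Rightarrow> real \<times> real" where
  "commutator_path n c = restrict (commutator_loop n c) {0..1}"

abbreviation constant_loop :: "real \<Rightarrow> real \<times> real" where
  "constant_loop \<equiv> restrict (\<lambda>_. 0) {0..1}"

lemma earring_loop_const: "earring_loop (\<lambda>_. 0)"
  using earring_loop_shrunk_petals[of 0] by simp

text \<open>The limit loop only runs forth and back along the first circle. Shrinking the arc
  parameter is a Lipschitz path in the loop space, since \<open>ramp\<close> is at most 1.\<close>

lemma path_component_commutator_path_0:
  "path_component_of (loop_space earring (0, 0)) constant_loop (commutator_path n 0)"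
proof -
  define h where "h s = restrict (\<lambda>t. petal (s * ramp (4 * real n * t))) {0..1}" for s
  have h: "h s \<in> mspace (loop_metric earring (0, 0))" for s
    unfolding h_def by (intro restrict_in_mspace_loop_earring earring_loop_shrunk_petals)
  have "Lipschitz_continuous_map (submetric euclidean_metric {0..1}) (loop_metric earring (0, 0)) h"
    unfolding Lipschitz_continuous_map_def
  proof (intro conjI exI ballI)
    fix x y
    have "dist (h x t) (h y t) \<le> 2 * pi * dist x y" if t: "t \<in> {0..1}" for t
    proof -
      have "dist (h x t) (h y t) \<le> 2 * pi * \<bar>x * ramp (4 * real n * t) - y * ramp (4 * real n * t)\<bar>"
        using t dist_petal by (simp add: h_def)
      also have "\<dots> = 2 * pi * (\<bar>x - y\<bar> * ramp (4 * real n * t))"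
        using ramp_bounds by (simp add: abs_mult flip: left_diff_distrib)
      also have "\<dots> \<le> 2 * pi * (\<bar>x - y\<bar> * 1)"
        using ramp_bounds by (intro mult_left_mono) auto
      finally show ?thesis
        by (simp add: dist_real_def)
    qed
    then show "mdist (loop_metric earring (0, 0)) (h x) (h y)
        \<le> 2 * pi * mdist (submetric euclidean_metric {0..1}) x y"
      using mdist_loop_earring_le[OF h h] by simp
  qed (use h in auto)
  then have "pathin (loop_space earring (0, 0)) h"
    using Lipschitz_continuous_imp_continuous_map
    by (fastforce simp: pathin_def loop_space_def mtopology_of_submetric)
  moreover have "h 0 = constant_loop" "h 1 = commutator_path n 0"
    by (auto simp: h_def commutator_path_def commutator_loop_def)
  ultimately show ?thesis
    unfolding path_component_of_def by blast
qed

text \<open>The shift by 2 keeps the second circle different from the first.\<close>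

lemma limitin_commutator_path:
  "limitin (loop_space earring (0, 0)) (\<lambda>k. commutator_path n (1 / real (k + 2)))
     (commutator_path n 0) sequentially"
proof -
  let ?m = "loop_metric earring (0, 0)"
  interpret L: Metric_space "mspace ?m" "mdist ?m"
    by (rule Metric_space_mspace_mdist)
  have mem: "commutator_path n (1 / real (k + 2)) \<in> mspace ?m" for k
    unfolding commutator_path_def
    by (intro restrict_in_mspace_loop_earring earring_loop_commutator_loop) simp
  have mem0: "commutator_path n 0 \<in> mspace ?m"
    using path_component_commutator_path_0[of n] path_component_in_topspace by fastforce
  have le: "mdist ?m (commutator_path n (1 / real (k + 2))) (commutator_path n 0) \<le> 2 * (1 / real (k + 2))" for k
    using mem mem0 dist_commutator_loop_limit[of "1 / real (k + 2)"]
    by (intro mdist_loop_earring_le) (auto simp: commutator_path_def)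
  have "(\<lambda>k. 2 * (1 / real (k + 2))) \<longlonglongrightarrow> 0"
    by real_asymp
  then have "(\<lambda>k. mdist ?m (commutator_path n (1 / real (k + 2))) (commutator_path n 0)) \<longlonglongrightarrow> 0"
    by (rule Lim_null_comparison[OF always_eventually, rotated]) (use le in simp)
  then show ?thesis
    unfolding loop_space_def mtopology_of_def L.limitin_metric_dist_null
    using mem mem0 by (intro conjI always_eventually allI)
qed

text \<open>Near a fixed loop all indices are bounded independently of \<open>k\<close>, so only
  finitely many of the closed sets come close, whatever the choice of \<open>k n\<close>.\<close>

lemma closedin_Union_index:
  assumes k: "\<And>n. k n \<ge> 2"
  shows "closedin (loop_space earring (0, 0))
    (\<Union>n\<in>{1..}. {f \<in> mspace (loop_metric earring (0, 0)). index (k n) f = 4 * pi * real n})"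
    (is "closedin ?X (\<Union>n\<in>_. ?F n)")
proof (rule closedin_locally_finite_Union)
  show "closedin ?X S" if "S \<in> ?F ` {1..}" for S
    using that closedin_index[OF k] by auto
  show "locally_finite_in ?X (?F ` {1..})"
    unfolding locally_finite_in_def
  proof (intro conjI ballI)
    fix f assume f: "f \<in> topspace ?X"
    let ?m = "loop_metric earring (0, 0)"
    interpret L: Metric_space "mspace ?m" "mdist ?m"
      by (rule Metric_space_mspace_mdist)
    obtain N :: nat where N:
      "\<And>k g. \<lbrakk>k \<ge> 2; earring_loop g; \<And>t. t \<in> {0..1} \<Longrightarrow> dist (f t) (g t) < 1 / 4\<rbrakk>
        \<Longrightarrow> \<bar>index k g\<bar> \<le> 2 * pi * N"
      using index_locally_bounded[of f] f by (auto simp: mspace_loop_earring)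
    have "n \<le> N" if g: "g \<in> ?F n" "g \<in> L.mball f (1 / 4)" for n g
    proof -
      have "\<bar>index (k n) g\<bar> \<le> 2 * pi * N"
      proof (rule N[OF k])
        show "earring_loop g"
          using g by (simp add: mspace_loop_earring)
        show "dist (f t) (g t) < 1 / 4" if "t \<in> {0..1}" for t
          using dist_le_mdist_loop_earring[OF _ _ that, of f g] f g by auto
      qed
      then have "pi * (2 * real n) \<le> pi * N"
        using g by simp
      then show ?thesis
        by simp
    qed
    then have "{U \<in> ?F ` {1..}. U \<inter> L.mball f (1 / 4) \<noteq> {}} \<subseteq> ?F ` {..N}"
      by blast
    then have "finite {U \<in> ?F ` {1..}. U \<inter> L.mball f (1 / 4) \<noteq> {}}"
      by (rule finite_subset) simp
    moreover have "openin ?X (L.mball f (1 / 4))"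
      by (simp add: loop_space_def mtopology_of_def)
    ultimately show "\<exists>V. openin ?X V \<and> f \<in> V \<and> finite {U \<in> ?F ` {1..}. U \<inter> V \<noteq> {}}"
      using f by (intro exI[of _ "L.mball f (1 / 4)"]) auto
  qed auto
qed

section \<open>Contradiction from a metric on the quotient\<close>

theorem theorem2:
  shows "\<not> metrizable_space
           (topological_pi1 (submetric euclidean_metric hawaiian_earring) (0, 0))"
proof
  let ?X = "loop_space earring (0, 0)"
  let ?M = "mspace (loop_metric earring (0, 0))"
  let ?\<Pi> = "path_component_of_set ?X"
  define Q where "Q = topological_pi1 earring (0, 0)"
  assume "metrizable_space (topological_pi1 (submetric euclidean_metric hawaiian_earring) (0, 0))"
  then have "metrizable_space Q"
    by (simp add: Q_def earring_def)
  then obtain M d where "Metric_space M d" and Q: "Q = Metric_space.mtopology M d"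
    unfolding metrizable_space_def by blast
  then interpret D: Metric_space M d
    by simp
  define e where "e = ?\<Pi> constant_loop"
  have quot: "continuous_map ?X Q ?\<Pi>"
    unfolding Q_def topological_pi1_def
    by (rule quotient_imp_continuous_map[OF quotient_map_quotient_topology])
  have const: "constant_loop \<in> ?M"
    by (intro restrict_in_mspace_loop_earring earring_loop_const)
  then have e: "e \<in> M"
    using continuous_map_image_subset_topspace[OF quot] by (auto simp: e_def Q)
  \<comment> \<open>For fixed \<open>n\<close> the classes converge to the class of the limit loop,
    which is \<open>e\<close>; this is where the balls of the assumed metric enter.\<close>
  have "\<exists>k\<ge>2. ?\<Pi> (commutator_path n (1 / real k)) \<in> D.mball e (1 / real (Suc n))" for n
  proof -
    have "?\<Pi> (commutator_path n 0) = e"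
      using path_component_of_equiv[of ?X constant_loop "commutator_path n 0"]
        path_component_commutator_path_0[of n] by (auto simp: e_def)
    then have "limitin Q (\<lambda>k. ?\<Pi> (commutator_path n (1 / real (k + 2)))) e sequentially"
      using continuous_map_limit[OF quot limitin_commutator_path[of n]] by (simp add: o_def)
    moreover have "openin Q (D.mball e (1 / real (Suc n)))"
      by (simp add: Q)
    moreover have "e \<in> D.mball e (1 / real (Suc n))"
      using e by simp
    ultimately have "\<forall>\<^sub>F k in sequentially. ?\<Pi> (commutator_path n (1 / real (k + 2))) \<in> D.mball e (1 / real (Suc n))"
      unfolding limitin_def by blast
    then obtain k where "?\<Pi> (commutator_path n (1 / real (k + 2))) \<in> D.mball e (1 / real (Suc n))"
      by (auto simp: eventually_sequentially)
    then show ?thesis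
      by (intro exI[of _ "k + 2"]) simp
  qed
  then obtain k where k: "\<And>n. k n \<ge> 2"
    and near: "\<And>n. ?\<Pi> (commutator_path n (1 / real (k n))) \<in> D.mball e (1 / real (Suc n))"
    by metis
  \<comment> \<open>\<open>A\<close> is closed, is a union of path components and contains every
    chosen loop with \<open>n \<ge> 1\<close>. The image of its complement will be an open
    neighbourhood of \<open>e\<close> that the chosen classes avoid.\<close>
  define A where "A = (\<Union>n\<in>{1..}. {f \<in> ?M. index (k n) f = 4 * pi * real n})"
  have saturated: "f \<in> A \<longleftrightarrow> g \<in> A" if "path_component_of ?X f g" for f g
    using that index_path_component[OF k that] path_component_in_topspace[OF that]
    by (auto simp: A_def)
  have same: "path_component_of ?X f g" if "?\<Pi> f = ?\<Pi> g" "g \<in> ?M" for f g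
    using path_component_of_refl[of ?X g] that by (metis mem_Collect_eq topspace_loop_space)
  have "f \<in> ?M - A" if "f \<in> ?M" "?\<Pi> f = ?\<Pi> g" "g \<in> ?M - A" for f g
    using that same saturated by blast
  then have "{f \<in> topspace ?X. ?\<Pi> f \<in> ?\<Pi> ` (?M - A)} = ?M - A"
    by auto
  then have "openin Q (?\<Pi> ` (?M - A))"
    using closedin_Union_index[of k, OF k]
    by (auto simp: Q_def topological_pi1_def openin_quotient_topology A_def closedin_def)
  moreover have "e \<in> ?\<Pi> ` (?M - A)"
  proof -
    \<comment> \<open>The constant loop is the zeroth power, so its index is 0, whereas the union
      \<open>A\<close> starts at \<open>n = 1\<close>.\<close>
    have "commutator_loop 0 c = (\<lambda>_. 0)" for c
      by (simp add: commutator_loop_def fun_eq_iff ramp_values)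
    then have "index (k n) constant_loop = 0" for n
      using index_restrict[OF k earring_loop_commutator_loop[OF k], of n 0 n]
        index_commutator_loop[OF k, of n 0] by simp
    then show ?thesis
      using const by (auto simp: e_def A_def)
  qed
  ultimately obtain r where r: "r > 0" "D.mball e r \<subseteq> ?\<Pi> ` (?M - A)"
    unfolding Q D.openin_mtopology by blast
  \<comment> \<open>Besides a small radius, \<open>n \<ge> 1\<close> is required for the chosen loop
    to lie in \<open>A\<close>.\<close>
  obtain n :: nat where n: "n \<ge> 1" "1 / real (Suc n) < r"
  proof -
    obtain m where m: "1 / real (Suc m) < r"
      using nat_approx_posE[OF r(1)] by blast
    have "1 / real (Suc (Suc m)) \<le> 1 / real (Suc m)"
      by (intro divide_left_mono) auto
    with m that[of "Suc m"] show ?thesis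
      by simp
  qed
  let ?w = "commutator_path n (1 / real (k n))"
  have w: "?w \<in> ?M" "index (k n) ?w = 4 * pi * n"
    using k by (simp_all add: commutator_path_def restrict_in_mspace_loop_earring
        earring_loop_commutator_loop index_restrict index_commutator_loop)
  have "?\<Pi> ?w \<in> D.mball e r"
    using near[of n] n(2) by auto
  then obtain g where g: "g \<in> ?M - A" "?\<Pi> ?w = ?\<Pi> g"
    using r(2) by blast
  then have "path_component_of ?X ?w g"
    by (intro same) auto
  moreover have "?w \<in> A"
    using w n(1) by (auto simp: A_def)
  ultimately show False
    using saturated g by blast
qed

end
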